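(* Let $G$ be a 2-connected sphere graph, let $\alpha$ be an out-degree function on $V(G)$, let $D$ and $D'$ be two strongly connected $\alpha$-orientations of $G$, and let $f$ be an arbitrary face of $G$. Then the flip-distance from $D'$ to $D$ is $$d(D',D)=\sum_{g\in\mathcal{F}(G)}\bigl(z_{D'-D}(f,g)-z_{\min}(f)\bigr),$$ where $$z_{\min}(f)=\min\{z_{D'-D}(f,g): g\in\mathcal{F}(G)\}.$$
   Context: A sphere graph is a (finite) planar graph embedded on the sphere; $\mathcal{F}(G)$ is the set of all its faces. An orientation $D$ of $G$ assigns a direction to each edge; given $\alpha:V(G)\to\mathbb{Z}_{\ge 0}$, $D$ is an $\alpha$-orientation if every vertex $v$ has out-degree $d_D^+(v)=\alpha(v)$. For a directed edge $e$, a face incident with $e$ is left of $e$ if it lies to the left side of $e$ when following the direction of $e$ (with respect to a fixed orientation of the sphere). The facial cycle (boundary) of a face $g$ is ccw with respect to $g$ if it is a directed cycle with $g$ lying to its left, and cw with respect to $g$ if it is a directed cycle with $g$ lying to its right. A flip on a face $g$ (any face of $G$ is allowed) whose facial cycle is ccw with respect to $g$ in the current orientation is the reversal of all edges of that facial cycle (making it cw with respect to $g$). A flip sequence is a finite (possibly empty) sequence of flips applied successively. The flip-distance $d(D',D)$ is the minimum number of flips in a flip sequence transforming $D'$ into $D$; the equality for $d(D',D)$ includes the assertion that such a flip sequence exists. $D'-D$ denotes the directed graph obtained from $D'$ by removing those edges which have the same direction in $D$ (so it consists of the edges oriented differently in $D$ and $D'$, directed as in $D'$). For a fixed face $f$,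 $z_{D'-D}(f,\cdot):\mathcal{F}(G)\to\mathbb{Z}$ is the (well-defined, unique) function with: (1) $z_{D'-D}(f,f)=0$; (2) if $g_1$ and $g_2$ are two faces sharing a common edge $e$, then $z_{D'-D}(f,g_2)=z_{D'-D}(f,g_1)+1$ if $e\in D'-D$ and $g_2$ is left of $e$; $z_{D'-D}(f,g_2)=z_{D'-D}(f,g_1)-1$ if $e\in D'-D$ and $g_1$ is left of $e$; and $z_{D'-D}(f,g_2)=z_{D'-D}(f,g_1)$ otherwise. *)

theory Defs
  imports
    "Graph_Theory.Digraph_Component"
    "Graph_Theory.Bidirected_Digraph"
    "HOL-Combinatorics.Orbits"
    "HOL-Library.FuncSet"
begin

text \<open>
  A connected graph embedded on the oriented sphere is given by its rotation system. The graph
  itself is a symmetric digraph \<open>G\<close> each of whose edges occurs as two mutually reverse arcs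
  (``darts''), exchanged by \<open>edge_rev\<close>. The map \<open>edge_succ\<close> sends a dart to the next dart, in
  clockwise order, among those leaving the same vertex.
\<close>

record 'a comb_map =
  edge_rev :: "'a \<Rightarrow> 'a"
  edge_succ :: "'a \<Rightarrow> 'a"

definition edges :: "('v, 'a) pre_digraph \<Rightarrow> 'a comb_map \<Rightarrow> 'a set set" where
  "edges G M = (\<lambda>a. {a, edge_rev M a}) ` arcs G"

text \<open>
  Arriving along a dart \<open>a\<close> and leaving along the clockwise successor of \<open>edge_rev a\<close> is the
  leftmost turn. So iterating \<open>face_succ\<close> from \<open>a\<close> walks along the boundary of the face to the
  left of \<open>a\<close>, keeping it on the left. A face is represented by the set of all darts that have
  it on their left; the two faces incident with the edge of \<open>a\<close> are \<open>left_face M a\<close> and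
  \<open>right_face M a\<close>.
\<close>

definition face_succ :: "'a comb_map \<Rightarrow> 'a \<Rightarrow> 'a" where
  "face_succ M = edge_succ M \<circ> edge_rev M"

definition left_face :: "'a comb_map \<Rightarrow> 'a \<Rightarrow> 'a set" where
  "left_face M a = orbit (face_succ M) a"

definition right_face :: "'a comb_map \<Rightarrow> 'a \<Rightarrow> 'a set" where
  "right_face M a = left_face M (edge_rev M a)"

definition faces :: "('v, 'a) pre_digraph \<Rightarrow> 'a comb_map \<Rightarrow> 'a set set" where
  "faces G M = left_face M ` arcs G"

text \<open>
  The surface carrying a connected rotation system is the sphere iff its Euler characteristic
  \<open>V - E + F\<close> is 2. Parallel edges and loops are allowed here.
\<close>

locale sphere_graph = fin_digraph G + bidirected_digraph G "edge_rev M"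
  for G :: "('v, 'a) pre_digraph" and M :: "'a comb_map" +
  assumes edge_succ_permutes: "edge_succ M permutes arcs G"
    and edge_succ_cyclic:
      "\<And>v. v \<in> verts G \<Longrightarrow> out_arcs G v \<noteq> {} \<Longrightarrow> cyclic_on (edge_succ M) (out_arcs G v)"
    and connected_graph: "connected G"
    and euler_sphere: "card (verts G) + card (faces G M) = card (edges G M) + 2"

text \<open>
  For connected simple graphs, having at least two edges means having at least three vertices.
  With parallel edges, two vertices joined by at least two edges also count as 2-connected.
\<close>

definition two_connected :: "('v, 'a) pre_digraph \<Rightarrow> 'a comb_map \<Rightarrow> bool" where
  "two_connected G M \<longleftrightarrow>
     loopfree_digraph G \<and> card (edges G M) \<ge> 2 \<and> connected G \<and>
     (\<forall>v \<in> verts G. connected (pre_digraph.del_vert G v))"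

text \<open>An orientation is a set of darts that contains exactly one of the two darts of each edge.\<close>

definition orientation :: "('v, 'a) pre_digraph \<Rightarrow> 'a comb_map \<Rightarrow> 'a set \<Rightarrow> bool" where
  "orientation G M D \<longleftrightarrow> D \<subseteq> arcs G \<and> (\<forall>a \<in> arcs G. a \<in> D \<longleftrightarrow> edge_rev M a \<notin> D)"

definition oriented :: "('v, 'a) pre_digraph \<Rightarrow> 'a set \<Rightarrow> ('v, 'a) pre_digraph" where
  "oriented G D = G\<lparr>arcs := D\<rparr>"

definition alpha_orientation ::
  "('v, 'a) pre_digraph \<Rightarrow> 'a comb_map \<Rightarrow> ('v \<Rightarrow> nat) \<Rightarrow> 'a set \<Rightarrow> bool" where
  "alpha_orientation G M \<alpha> D \<longleftrightarrow>
     orientation G M D \<and> (\<forall>v \<in> verts G. out_degree (oriented G D) v = \<alpha> v)"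

text \<open>
  In a 2-connected sphere graph every facial walk is a cycle. As the face \<open>g\<close> is the set of the
  darts of its boundary that have \<open>g\<close> on their left, the facial cycle of \<open>g\<close> is a directed cycle
  of \<open>D\<close> with \<open>g\<close> to its left iff \<open>g \<subseteq> D\<close>.
\<close>

definition ccw_face :: "'a set \<Rightarrow> 'a set \<Rightarrow> bool" where
  "ccw_face D g \<longleftrightarrow> g \<subseteq> D"

definition flip_face :: "'a comb_map \<Rightarrow> 'a set \<Rightarrow> 'a set \<Rightarrow> 'a set" where
  "flip_face M g D = (D - g) \<union> edge_rev M ` g"

definition flip_step ::
  "('v, 'a) pre_digraph \<Rightarrow> 'a comb_map \<Rightarrow> 'a set \<Rightarrow> 'a set \<Rightarrow> bool" where
  "flip_step G M D1 D2 \<longleftrightarrow> (\<exists>g \<in> faces G M. ccw_face D1 g \<and> D2 = flip_face M g D1)"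

definition flip_sequence ::
  "('v, 'a) pre_digraph \<Rightarrow> 'a comb_map \<Rightarrow> nat \<Rightarrow> 'a set \<Rightarrow> 'a set \<Rightarrow> bool" where
  "flip_sequence G M n D1 D2 \<longleftrightarrow> (flip_step G M ^^ n) D1 D2"

text \<open>Only meaningful if some flip sequence transforms the first orientation into the second.\<close>

definition flip_distance ::
  "('v, 'a) pre_digraph \<Rightarrow> 'a comb_map \<Rightarrow> 'a set \<Rightarrow> 'a set \<Rightarrow> nat" where
  "flip_distance G M D1 D2 = (LEAST n. flip_sequence G M n D1 D2)"

text \<open>
  The arcs of the digraph \<open>D' - D\<close> are the set difference of the two dart sets. The dart \<open>a\<close>
  ranges over both directions of each edge, so (\<open>right_face M a\<close>, \<open>left_face M a\<close>) takes every
  ordered pair of faces sharing the edge.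
\<close>

definition is_potential ::
  "('v, 'a) pre_digraph \<Rightarrow> 'a comb_map \<Rightarrow> 'a set \<Rightarrow> 'a set \<Rightarrow> 'a set \<Rightarrow> ('a set \<Rightarrow> int) \<Rightarrow> bool" where
  "is_potential G M D' D f z \<longleftrightarrow>
     z f = 0 \<and>
     (\<forall>a \<in> arcs G. z (left_face M a) =
        (if a \<in> D' - D then z (right_face M a) + 1
         else if edge_rev M a \<in> D' - D then z (right_face M a) - 1
         else z (right_face M a)))"

text \<open>
  The restriction to extensional functions (\<open>undefined\<close> off the faces) makes the function unique
  as a total function of HOL.
\<close>

definition potential ::
  "('v, 'a) pre_digraph \<Rightarrow> 'a comb_map \<Rightarrow> 'a set \<Rightarrow> 'a set \<Rightarrow> 'a set \<Rightarrow> 'a set \<Rightarrow> int" where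
  "potential G M D' D f =
     (THE z. z \<in> extensional (faces G M) \<and> is_potential G M D' D f z)"

definition z_min ::
  "('v, 'a) pre_digraph \<Rightarrow> 'a comb_map \<Rightarrow> 'a set \<Rightarrow> 'a set \<Rightarrow> 'a set \<Rightarrow> int" where
  "z_min G M D' D f = Min (potential G M D' D f ` faces G M)"

end

theory Submission
  imports Defs
begin

text \<open>
  Let \<open>c\<close> be the difference of the indicator functions of \<open>D'\<close> and \<open>D\<close>. As the out-degrees agree,
  \<open>c\<close> is a circulation, so on the sphere it is the coboundary of a function on the faces, unique up
  to a constant (tree-cotree argument: Euler's formula makes the dual of the complement of a spanning
  tree a spanning tree). A flip at \<open>g\<close> lowers this function by one at \<open>g\<close> only. So the numbers of
  flips at the faces in any flip sequence from \<open>D'\<close> to \<open>D\<close> form a nonnegative potential of \<open>c\<close>,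
  and the smallest such potential is \<open>z - z_min\<close>. Conversely, every nonnegative potential \<open>w\<close> of
  \<open>c\<close> is realised: a strongly connected orientation carries a positive circulation, whose face
  potential \<open>h\<close> increases from right to left across every arc. Among the faces maximising \<open>w\<close>,
  the one maximising \<open>h\<close> is ccw and can be flipped.
\<close>

section \<open>Spanning trees\<close>

text \<open>Here \<open>t\<close> plays the tail map, \<open>r\<close> the reversal, and
  \<open>cut\<close> is connectedness. \<open>T\<close> is the set of darts of a spanning tree;
  having no cycle, it carries no obstruction to being a gradient. The setting is abstract so as to
  serve both the graph (\<open>t = tail G\<close>) and its dual
  (\<open>t = left_face M\<close>).\<close>

lemma ex_spanning_arcs:
  fixes t :: "'a \<Rightarrow> 'v" and r :: "'a \<Rightarrow> 'a"
  assumes "finite A" "finite X" "X \<noteq> {}"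
    and r: "\<And>a. a \<in> A \<Longrightarrow> r a \<in> A" "\<And>a. a \<in> A \<Longrightarrow> r (r a) = a" "\<And>a. a \<in> A \<Longrightarrow> r a \<noteq> a"
    and cut: "\<And>Y. Y \<subseteq> X \<Longrightarrow> Y \<noteq> {} \<Longrightarrow> Y \<noteq> X \<Longrightarrow> \<exists>a\<in>A. t a \<in> Y \<and> t (r a) \<in> X - Y"
  obtains T where "T \<subseteq> A" "r ` T \<subseteq> T" "card T + 2 = 2 * card X"
    "\<And>c :: 'a \<Rightarrow> int. (\<And>a. a \<in> T \<Longrightarrow> c (r a) = - c a) \<Longrightarrow>
       \<exists>z. \<forall>a\<in>T. c a = z (t a) - z (t (r a))"
proof -
  \<comment> \<open>The tree is grown one vertex at a time: \<open>Y\<close> is its current vertex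
    set, and \<open>cut\<close> supplies an edge leaving \<open>Y\<close>.\<close>
  have "\<exists>Y T. Y \<subseteq> X \<and> card Y = Suc n \<and> T \<subseteq> A \<and> r ` T \<subseteq> T \<and> t ` T \<subseteq> Y \<and> card T + 2 = 2 * card Y \<and>
      (\<forall>c :: 'a \<Rightarrow> int. (\<forall>a\<in>T. c (r a) = - c a) \<longrightarrow> (\<exists>z. \<forall>a\<in>T. c a = z (t a) - z (t (r a))))"
    if "Suc n \<le> card X" for n
    using that
  proof (induction n)
    case 0
    obtain x where "x \<in> X" using \<open>X \<noteq> {}\<close> by blast
    then show ?case by (intro exI[of _ "{x}"] exI[of _ "{}"]) auto
  next
    case (Suc n)
    then obtain Y T where Y: "Y \<subseteq> X" "card Y = Suc n" "T \<subseteq> A" "r ` T \<subseteq> T" "t ` T \<subseteq> Y"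
      "card T + 2 = 2 * card Y"
      and pot: "\<And>c :: 'a \<Rightarrow> int. (\<forall>a\<in>T. c (r a) = - c a) \<Longrightarrow> \<exists>z. \<forall>a\<in>T. c a = z (t a) - z (t (r a))"
      by auto
    have "finite Y" "finite T" using Y assms(1,2) finite_subset by blast+
    have "Y \<noteq> {}" "Y \<noteq> X" using Y Suc.prems by auto
    then obtain b where b: "b \<in> A" "t b \<in> Y" "t (r b) \<in> X" "t (r b) \<notin> Y"
      using cut[of Y] Y(1) by auto
    have notin: "b \<notin> T" "r b \<notin> T" using b Y(4,5) by auto
    let ?T = "insert b (insert (r b) T)" and ?Y = "insert (t (r b)) Y"
    have "\<exists>z. \<forall>a\<in>?T. c a = z (t a) - z (t (r a))"
      if c: "\<forall>a\<in>?T. c (r a) = - c a" for c :: "'a \<Rightarrow> int"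
    proof -
      obtain z where z: "\<forall>a\<in>T. c a = z (t a) - z (t (r a))" using pot[of c] c by auto
      \<comment> \<open>The new vertex is a leaf, so the equation for \<open>b\<close> alone
        dictates its value and no earlier equation is disturbed.\<close>
      let ?z = "z(t (r b) := z (t b) - c b)"
      have "c a = ?z (t a) - ?z (t (r a))" if "a \<in> T" for a
      proof -
        have "t a \<in> Y" "t (r a) \<in> Y" using that Y(4,5) by auto
        then have "t a \<noteq> t (r b)" "t (r a) \<noteq> t (r b)" using b(4) by auto
        then show ?thesis using z that by simp
      qed
      moreover have "t b \<noteq> t (r b)" using b by auto
      moreover have "r (r b) = b" using r(2) b(1) by simp
      moreover have "c (r b) = - c b" using c by simp
      ultimately show ?thesis by (intro exI[of _ ?z]) auto
    qed
    moreover have "card ?T = card T + 2" "card ?Y = Suc (card Y)"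
      using notin r(3)[OF b(1)] b(4) \<open>finite T\<close> \<open>finite Y\<close> by auto
    moreover have "r ` ?T \<subseteq> ?T" using Y(4) r(2)[OF b(1)] by auto
    moreover have "t ` ?T \<subseteq> ?Y" using Y(5) b(2) by auto
    moreover have "?Y \<subseteq> X" "?T \<subseteq> A" using Y(1,3) b(1,3) r(1) by auto
    ultimately show ?case
      using Y(2,6) by (intro exI[of _ ?Y] exI[of _ ?T] conjI allI impI) simp_all
  qed
  from this[of "card X - 1"] obtain Y T where YT: "Y \<subseteq> X" "card Y = card X" "T \<subseteq> A" "r ` T \<subseteq> T"
      "card T + 2 = 2 * card Y"
      "\<forall>c :: 'a \<Rightarrow> int. (\<forall>a\<in>T. c (r a) = - c a) \<longrightarrow> (\<exists>z. \<forall>a\<in>T. c a = z (t a) - z (t (r a)))"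
    using assms(2,3) by (auto simp: Suc_leI card_gt_0_iff)
  show thesis using YT by (intro that[of T]) auto
qed

section \<open>Circulations and functions on the faces\<close>

context sphere_graph
begin

definition circulation :: "('a \<Rightarrow> int) \<Rightarrow> bool" where
  "circulation c \<longleftrightarrow> (\<forall>a\<in>arcs G. c (edge_rev M a) = - c a) \<and>
     (\<forall>v\<in>verts G. (\<Sum>a\<in>out_arcs G v. c a) = 0)"

text \<open>The gradient in the dual graph: since \<open>right_face M a\<close> is
  \<open>left_face M (edge_rev M a)\<close>, it has the shape of
  \<open>p (tail G a) - p (tail G (edge_rev M a))\<close>.\<close>

definition coboundary :: "('a set \<Rightarrow> int) \<Rightarrow> 'a \<Rightarrow> int" where
  "coboundary z a = z (left_face M a) - z (right_face M a)"

text \<open>A walk from inside \<open>Y\<close> to outside must leave \<open>Y\<close> somewhere; if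
  it traverses an arc backwards there, the reverse arc is taken. The head is written as the tail of
  the reverse to match \<open>ex_spanning_arcs\<close>.\<close>

lemma ex_cut_arc:
  assumes Y: "Y \<subseteq> verts G" "Y \<noteq> {}" "Y \<noteq> verts G"
  shows "\<exists>a\<in>arcs G. tail G a \<in> Y \<and> tail G (edge_rev M a) \<in> verts G - Y"
proof (rule ccontr)
  assume no: "\<not> ?thesis"
  obtain u where u: "u \<in> Y" using Y by auto
  obtain v where v: "v \<in> verts G" "v \<notin> Y" using Y by auto
  have "u \<rightarrow>\<^sup>*\<^bsub>with_proj (mk_symmetric G)\<^esub> v"
    using connected_graph u v Y(1) by (auto simp: connected_def strongly_connected_def)
  then have "(u, v) \<in> (arcs_ends (with_proj (mk_symmetric G)))\<^sup>*"
    by (rule reachable_rtranclI)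
  then have "v \<in> Y"
  proof induction
    case (step y x)
    then obtain a where a: "a \<in> arcs G" "(y, x) = (tail G a, head G a) \<or> (y, x) = (head G a, tail G a)"
      by (auto simp: mk_symmetric_def arcs_ends_conv)
    have "x \<in> verts G" using a by auto
    with no a step.IH show ?case
      using tail_arev[OF a(1)] arev_in_arcs[OF a(1)] arev_arev[of a] by (metis DiffI prod.inject)
  qed (use u in auto)
  with v show False by simp
qed

lemma left_face_rev: "left_face M (edge_rev M a) = right_face M a"
  by (simp add: right_face_def)

lemma right_face_rev: "right_face M (edge_rev M a) = left_face M a"
  by (simp add: right_face_def)

lemma permutation_face_succ: "permutation (face_succ M)"
  unfolding face_succ_def permutation_permutes
  using permutes_compose[OF arev_permutes_arcs edge_succ_permutes] finite_arcs by blast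

text \<open>As \<open>edge_rev\<close> is an involution, \<open>edge_succ M a\<close> is
  \<open>face_succ M (edge_rev M a)\<close>, one step further along the boundary of the face to the
  right of \<open>a\<close>.\<close>

lemma left_face_succ: "left_face M (edge_succ M a) = right_face M a"
  using permutation_orbit_step[OF permutation_face_succ, of "edge_rev M a"]
  by (simp add: left_face_def right_face_def face_succ_def)

text \<open>The orbits of a permutation are disjoint or equal.\<close>

lemma mem_face_iff:
  assumes "g \<in> faces G M" shows "a \<in> g \<longleftrightarrow> left_face M a = g"
proof -
  obtain b where b: "g = orbit (face_succ M) b" using assms by (auto simp: faces_def left_face_def)
  show ?thesis
  proof
    assume "a \<in> g"
    then have "b \<in> orbit (face_succ M) a"
      using b orbit_swap permutation_self_in_orbit permutation_face_succ by metis
    with \<open>a \<in> g\<close> show "left_face M a = g"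
      unfolding left_face_def b by (auto intro: orbit_trans)
  next
    assume "left_face M a = g"
    then show "a \<in> g"
      using permutation_self_in_orbit[OF permutation_face_succ] by (auto simp: left_face_def)
  qed
qed

lemma left_face_in_faces: "a \<in> arcs G \<Longrightarrow> left_face M a \<in> faces G M"
  by (simp add: faces_def)

lemma right_face_in_faces: "a \<in> arcs G \<Longrightarrow> right_face M a \<in> faces G M"
  by (simp add: faces_def right_face_def)

lemma finite_faces: "finite (faces G M)"
  by (simp add: faces_def)

lemma card_arcs: "card (arcs G) = 2 * card (edges G M)"
proof -
  have Un: "\<Union> (edges G M) = arcs G" by (auto simp: edges_def)
  have "2 * card (edges G M) = card (\<Union> (edges G M))"
  proof (rule card_partition)
    show "card c = 2" if "c \<in> edges G M" for c
      using that arev_neq by (auto simp: edges_def card_2_iff)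
    show "c1 \<inter> c2 = {}" if "c1 \<in> edges G M" "c2 \<in> edges G M" "c1 \<noteq> c2" for c1 c2
      using that arev_eq_iff by (auto simp: edges_def)
  qed (simp_all add: Un, simp add: edges_def)
  then show ?thesis by (simp add: Un)
qed

lemma sum_arcs_rev: "(\<Sum>a\<in>arcs G. h (edge_rev M a)) = (\<Sum>a\<in>arcs G. h a)"
  using sum.permute[OF arev_permutes_arcs, of h] by (simp add: comp_def)

lemma sum_out_arcs_tail:
  fixes h :: "'a \<Rightarrow> int"
  shows "(\<Sum>a\<in>arcs G. h a) = (\<Sum>v\<in>verts G. \<Sum>a\<in>out_arcs G v. h a)"
  using sum.group[of "arcs G" "verts G" "tail G" h] unfolding out_arcs_def by fastforce

text \<open>A circulation that is a gradient on its support is orthogonal to itself.\<close>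

lemma circulation_eq_0:
  assumes c: "circulation c"
    and p: "\<And>a. a \<in> arcs G \<Longrightarrow> c a \<noteq> 0 \<Longrightarrow> c a = p (tail G a) - p (tail G (edge_rev M a))"
    and "a \<in> arcs G"
  shows "c a = 0"
proof -
  \<comment> \<open>Summation by parts: grouped by tails, the sum weights each vertex's net outflow
    by \<open>p\<close>. Reversing all darts then reduces the sum over heads to this one.\<close>
  let ?S = "\<Sum>a\<in>arcs G. c a * p (tail G a)"
  have "?S = (\<Sum>v\<in>verts G. p v * (\<Sum>a\<in>out_arcs G v. c a))"
    unfolding sum_out_arcs_tail sum_distrib_left by (intro sum.cong) auto
  also have "\<dots> = 0" using c by (simp add: circulation_def)
  finally have S: "?S = 0" .
  have "(\<Sum>a\<in>arcs G. c a * p (tail G (edge_rev M a))) =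
      (\<Sum>a\<in>arcs G. - c (edge_rev M a) * p (tail G (edge_rev M a)))"
    using c by (intro sum.cong) (auto simp: circulation_def)
  also have "\<dots> = (\<Sum>a\<in>arcs G. - c a * p (tail G a))"
    by (rule sum_arcs_rev)
  also have "\<dots> = 0" using S by (simp add: sum_negf)
  finally have S': "(\<Sum>a\<in>arcs G. c a * p (tail G (edge_rev M a))) = 0" .
  have "(\<Sum>a\<in>arcs G. c a * c a) =
      (\<Sum>a\<in>arcs G. c a * p (tail G a) - c a * p (tail G (edge_rev M a)))"
  proof (rule sum.cong)
    \<comment> \<open>The gradient formula is available only on the support of \<open>c\<close>; off
      it both sides vanish.\<close>
    fix a assume "a \<in> arcs G"
    then show "c a * c a = c a * p (tail G a) - c a * p (tail G (edge_rev M a))"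
      using p[of a] by (cases "c a = 0") (metis mult_zero_left diff_0_right, metis right_diff_distrib)
  qed simp
  also have "\<dots> = 0" using S S' by (simp add: sum_subtractf)
  finally have "\<forall>a\<in>arcs G. c a * c a = 0"
    by (subst (asm) sum_nonneg_eq_0_iff) auto
  then show ?thesis using assms(3) by simp
qed

text \<open>By \<open>left_face_succ\<close>, the faces right of the darts at a vertex are those
  left of their successors. As \<open>edge_succ\<close> permutes these darts, the two sums
  cancel.\<close>

lemma circulation_coboundary: "circulation (coboundary z)"
proof -
  have "(\<Sum>a\<in>out_arcs G v. coboundary z a) = 0" if v: "v \<in> verts G" for v
  proof (cases "out_arcs G v = {}")
    case False
    then have cyc: "cyclic_on (edge_succ M) (out_arcs G v)" using edge_succ_cyclic v by blast
    have "edge_succ M ` out_arcs G v \<subseteq> out_arcs G v"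
      using orbit_cyclic_eq3[OF cyc] orbit.base by fastforce
    moreover have "inj_on (edge_succ M) (out_arcs G v)"
      using edge_succ_permutes permutes_inj_on by blast
    moreover have "finite (out_arcs G v)" by blast
    ultimately have "bij_betw (edge_succ M) (out_arcs G v) (out_arcs G v)"
      by (simp add: bij_betw_def endo_inj_surj)
    then have "(\<Sum>a\<in>out_arcs G v. z (left_face M a)) =
        (\<Sum>a\<in>out_arcs G v. z (left_face M (edge_succ M a)))"
      by (rule sum.reindex_bij_betw[symmetric])
    then show ?thesis by (simp add: coboundary_def left_face_succ sum_subtractf)
  qed simp
  then show ?thesis
    by (simp add: circulation_def coboundary_def left_face_rev right_face_rev)
qed

lemma circulation_diff:
  "circulation c \<Longrightarrow> circulation d \<Longrightarrow> circulation (\<lambda>a. c a - d a)"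
  by (simp add: circulation_def sum_subtractf)

text \<open>Rotating about a vertex crosses one edge at a time, so all faces around it share one
  value; connectedness carries this value from vertex to vertex.\<close>

lemma coboundary_eq_0_imp_const:
  assumes z: "\<And>a. a \<in> arcs G \<Longrightarrow> coboundary z a = 0"
    and "g \<in> faces G M" "h \<in> faces G M"
  shows "z g = z h"
proof -
  obtain b where b: "b \<in> arcs G" "g = left_face M b" using assms by (auto simp: faces_def)
  obtain d where d: "d \<in> arcs G" "h = left_face M d" using assms by (auto simp: faces_def)
  have star: "z (left_face M x) = z (left_face M y)"
    if "x \<in> out_arcs G v" "y \<in> out_arcs G v" for x y v
  proof -
    have v: "v \<in> verts G" using that by auto
    have "cyclic_on (edge_succ M) (out_arcs G v)" using edge_succ_cyclic v that by blast
    then have "orbit (edge_succ M) x = out_arcs G v" using that(1) by (simp add: orbit_cyclic_eq3)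
    then have "y \<in> orbit (edge_succ M) x" using that by simp
    then show ?thesis
    proof induction
      case base
      show ?case using z[of x] that by (simp add: left_face_succ coboundary_def)
    next
      case (step y)
      then have "y \<in> arcs G" using \<open>orbit (edge_succ M) x = out_arcs G v\<close> by auto
      then show ?case using z[of y] step.IH by (simp add: left_face_succ coboundary_def)
    qed
  qed
  \<comment> \<open>An arc leaving \<open>Y\<close> would give its far end an incident face of value
    \<open>z g\<close>, and by \<open>star\<close> put that end into \<open>Y\<close> as
    well.\<close>
  define Y where "Y = {v \<in> verts G. \<forall>a\<in>out_arcs G v. z (left_face M a) = z g}"
  have Y_I: "tail G x \<in> Y" if x: "x \<in> arcs G" "z (left_face M x) = z g" for x
    unfolding Y_def
  proof (intro CollectI conjI ballI)
    show "tail G x \<in> verts G" using x by simp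
    fix a assume "a \<in> out_arcs G (tail G x)"
    then have "z (left_face M a) = z (left_face M x)" using x by (intro star) auto
    then show "z (left_face M a) = z g" using x by simp
  qed
  have "tail G b \<in> Y" using b by (intro Y_I) auto
  have "Y = verts G"
  proof (rule ccontr)
    assume "Y \<noteq> verts G"
    moreover have "Y \<subseteq> verts G" "Y \<noteq> {}" using \<open>tail G b \<in> Y\<close> by (auto simp: Y_def)
    ultimately obtain a where a: "a \<in> arcs G" "tail G a \<in> Y"
      "tail G (edge_rev M a) \<in> verts G" "tail G (edge_rev M a) \<notin> Y"
      using ex_cut_arc[of Y] by auto
    have "z (left_face M a) = z g" using a(1,2) by (simp add: Y_def)
    then have "z (left_face M (edge_rev M a)) = z g"
      using z[OF a(1)] by (simp add: coboundary_def left_face_rev)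
    then have "tail G (edge_rev M a) \<in> Y"
      using a(1) by (intro Y_I arev_in_arcs)
    with a show False by simp
  qed
  then have "tail G d \<in> Y" using d by simp
  then show ?thesis using d by (simp add: Y_def)
qed

section \<open>Circulations are coboundaries\<close>

lemma circulation_imp_coboundary:
  assumes c: "circulation c"
  obtains z where "\<And>a. a \<in> arcs G \<Longrightarrow> c a = coboundary z a"
proof (cases "arcs G = {}")
  case False
  then have ne: "verts G \<noteq> {}" "faces G M \<noteq> {}" using wellformed by (fastforce simp: faces_def)+
  obtain T where T: "T \<subseteq> arcs G" "edge_rev M ` T \<subseteq> T" "card T + 2 = 2 * card (verts G)"
    and grad: "\<And>c :: 'a \<Rightarrow> int. (\<And>a. a \<in> T \<Longrightarrow> c (edge_rev M a) = - c a) \<Longrightarrow>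
       \<exists>p. \<forall>a\<in>T. c a = p (tail G a) - p (tail G (edge_rev M a))"
    using ex_spanning_arcs[OF finite_arcs finite_verts ne(1) arev_in_arcs arev_arev arev_neq ex_cut_arc]
    by blast
  \<comment> \<open>On a tree every antisymmetric function is a gradient, so a circulation supported
    there vanishes by \<open>circulation_eq_0\<close>.\<close>
  have tree_zero: "d a = 0"
    if d: "circulation d" and supp: "\<And>a. a \<in> arcs G - T \<Longrightarrow> d a = 0" and "a \<in> arcs G" for d a
  proof -
    obtain p where "\<forall>a\<in>T. d a = p (tail G a) - p (tail G (edge_rev M a))"
      using grad[of d] d T(1) by (auto simp: circulation_def)
    then show ?thesis using circulation_eq_0[OF d, of p a] supp that(3) by blast
  qed
  define C where "C = arcs G - T"
  have C: "finite C" "\<And>a. a \<in> C \<Longrightarrow> edge_rev M a \<noteq> a" using arev_neq by (auto simp: C_def)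
  have C_rev: "edge_rev M a \<in> C" if "a \<in> C" for a
    using that T(2) arev_arev[of a] by (auto simp: C_def)
  have cut: "\<exists>a\<in>C. left_face M a \<in> Q \<and> left_face M (edge_rev M a) \<in> faces G M - Q"
    if Q: "Q \<subseteq> faces G M" "Q \<noteq> {}" "Q \<noteq> faces G M" for Q
  proof (rule ccontr)
    assume no: "\<not> ?thesis"
    \<comment> \<open>If no edge of \<open>C\<close> crossed from \<open>Q\<close> to the other
      faces, the coboundary of the indicator of \<open>Q\<close> would be a circulation supported on
      the tree, hence zero, and the indicator would be constant.\<close>
    let ?z = "\<lambda>g. of_bool (g \<in> Q) :: int"
    have "coboundary ?z a = 0" if "a \<in> C" for a
    proof -
      have a: "a \<in> arcs G" using that by (simp add: C_def)
      have "left_face M a \<in> Q \<longleftrightarrow> right_face M a \<in> Q"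
        using no that C_rev[OF that] left_face_in_faces[OF a] right_face_in_faces[OF a]
          left_face_rev[of a] by (metis DiffI arev_arev)
      then show ?thesis by (simp add: coboundary_def)
    qed
    then have "coboundary ?z a = 0" if "a \<in> arcs G" for a
      using tree_zero[OF circulation_coboundary _ that] by (simp add: C_def)
    then have "?z g = ?z h" if "g \<in> faces G M" "h \<in> faces G M" for g h
      using coboundary_eq_0_imp_const[of ?z] that by blast
    then have "g \<in> Q \<longleftrightarrow> h \<in> Q" if "g \<in> faces G M" "h \<in> faces G M" for g h
      using that by (metis of_bool_eq_iff)
    with Q show False by blast
  qed
  obtain S where S: "S \<subseteq> C" "edge_rev M ` S \<subseteq> S" "card S + 2 = 2 * card (faces G M)"
    and dual_grad: "\<And>c :: 'a \<Rightarrow> int. (\<And>a. a \<in> S \<Longrightarrow> c (edge_rev M a) = - c a) \<Longrightarrow>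
       \<exists>z. \<forall>a\<in>S. c a = z (left_face M a) - z (left_face M (edge_rev M a))"
    using ex_spanning_arcs[OF C(1) finite_faces ne(2) C_rev arev_arev C(2) cut] by blast
  have "card C = card (arcs G) - card T"
    using T(1) by (simp add: C_def card_Diff_subset finite_subset)
  moreover have "card T \<le> card (arcs G)" using T(1) by (simp add: card_mono)
  ultimately have "card C + card T = 2 * card (edges G M)" using card_arcs by simp
  \<comment> \<open>With V, E, F vertices, edges and faces, \<open>C\<close> has 2E - 2(V - 1) darts
    and the dual tree \<open>S\<close> has 2(F - 1); Euler's formula equates them.\<close>
  then have "card S = card C" using S(3) T(3) euler_sphere by simp
  then have "S = C" using S(1) by (simp add: C_def card_subset_eq)
  with dual_grad[of c] c obtain z
    where z: "\<forall>a\<in>C. c a = z (left_face M a) - z (left_face M (edge_rev M a))"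
    by (auto simp: circulation_def C_def)
  \<comment> \<open>The difference is a circulation that vanishes on \<open>C\<close>, so it lives
    on the tree.\<close>
  have "c a - coboundary z a = 0" if "a \<in> arcs G" for a
    using tree_zero[OF circulation_diff[OF c circulation_coboundary] _ that, of z] z
    by (simp add: C_def coboundary_def right_face_def)
  then show ?thesis by (intro that[of z]) simp
qed auto

section \<open>Orientations and height functions\<close>

lemma orientation_subset: "orientation G M D \<Longrightarrow> D \<subseteq> arcs G"
  by (simp add: orientation_def)

lemma orientation_rev: "orientation G M D \<Longrightarrow> a \<in> arcs G \<Longrightarrow> edge_rev M a \<in> D \<longleftrightarrow> a \<notin> D"
  by (meson orientation_def)

text \<open>The function is 1 on the arcs of \<open>D' - D\<close> and -1 on their reverses; its sum
  at a vertex is the difference of two out-degrees, both given by \<alpha>.\<close>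

lemma circulation_orientation_diff:
  assumes D: "alpha_orientation G M \<alpha> D" and D': "alpha_orientation G M \<alpha> D'"
  shows "circulation (\<lambda>a. of_bool (a \<in> D') - of_bool (a \<in> D))"
proof -
  have out: "(\<Sum>a\<in>out_arcs G v. of_bool (a \<in> E)) = int (\<alpha> v)"
    if "v \<in> verts G" and E: "alpha_orientation G M \<alpha> E" for v E
  proof -
    have "out_arcs (oriented G E) v = out_arcs G v \<inter> E"
      using E orientation_subset by (fastforce simp: alpha_orientation_def oriented_def out_arcs_def)
    then have "card (out_arcs G v \<inter> E) = \<alpha> v"
      using that by (metis alpha_orientation_def out_degree_def)
    moreover have "finite (out_arcs G v)" by blast
    ultimately show ?thesis by (simp add: Int_def)
  qed
  show ?thesis
    unfolding circulation_def sum_subtractf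
    using out[OF _ D] out[OF _ D'] assms
    by (auto simp: alpha_orientation_def orientation_rev)
qed

text \<open>Net outflow is summed over outgoing darts only, so flow entering along an edge appears
  as \<open>x (edge_rev M a)\<close>. This lets flows be built arc by arc.\<close>

lemma sum_out_arcs_add_arc:
  fixes x :: "'a \<Rightarrow> int"
  assumes b: "b \<in> arcs G"
  shows "(\<Sum>a\<in>out_arcs G v. (x a + of_bool (a = b)) - (x (edge_rev M a) + of_bool (edge_rev M a = b))) =
    (\<Sum>a\<in>out_arcs G v. x a - x (edge_rev M a)) + of_bool (v = tail G b) - of_bool (v = head G b)"
proof -
  have eq: "edge_rev M a = b \<longleftrightarrow> a = edge_rev M b" for a by auto
  have fin: "finite (out_arcs G v)" by blast
  have "(\<Sum>a\<in>out_arcs G v. of_bool (a = b) :: int) = of_bool (v = tail G b)"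
    using fin b by (auto simp: of_bool_def)
  moreover have "(\<Sum>a\<in>out_arcs G v. of_bool (a = edge_rev M b) :: int) = of_bool (v = head G b)"
    using fin b by (auto simp: of_bool_def)
  ultimately show ?thesis by (simp add: sum.distrib sum_subtractf eq)
qed

text \<open>Counting how often a walk from \<open>u\<close> to \<open>v\<close> uses each arc gives
  a unit flow from \<open>u\<close> to \<open>v\<close>.\<close>

lemma reachable_imp_flow:
  assumes "u \<rightarrow>\<^sup>*\<^bsub>oriented G D\<^esub> v" "D \<subseteq> arcs G"
  shows "\<exists>x :: 'a \<Rightarrow> int. (\<forall>a. 0 \<le> x a) \<and> (\<forall>a. a \<notin> D \<longrightarrow> x a = 0) \<and>
    (\<forall>w. (\<Sum>a\<in>out_arcs G w. x a - x (edge_rev M a)) = of_bool (w = u) - of_bool (w = v))"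
proof -
  have "(u, v) \<in> (arcs_ends (oriented G D))\<^sup>*" using assms(1) by (rule reachable_rtranclI)
  then show ?thesis
  proof induction
    case base
    show ?case by (intro exI[of _ "\<lambda>_. 0"]) auto
  next
    case (step y w)
    then obtain x :: "'a \<Rightarrow> int" where x: "\<forall>a. 0 \<le> x a" "\<forall>a. a \<notin> D \<longrightarrow> x a = 0"
      "\<And>w. (\<Sum>a\<in>out_arcs G w. x a - x (edge_rev M a)) = of_bool (w = u) - of_bool (w = y)"
      by blast
    from step obtain b where b: "b \<in> D" "tail G b = y" "head G b = w"
      by (auto simp: arcs_ends_conv oriented_def)
    let ?x = "\<lambda>a. x a + of_bool (a = b)"
    have "(\<Sum>a\<in>out_arcs G v. ?x a - ?x (edge_rev M a)) = of_bool (v = u) - of_bool (v = w)" for v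
      using sum_out_arcs_add_arc[of b x v] b assms(2) x(3) by auto
    then show ?case using x(1,2) b by (intro exI[of _ ?x]) auto
  qed
qed

text \<open>Such a height function says that the dual of the oriented graph is acyclic.\<close>

lemma strongly_connected_imp_height:
  assumes D: "orientation G M D" and sc: "strongly_connected (oriented G D)"
  obtains h where "\<And>a. a \<in> D \<Longrightarrow> coboundary h a > 0"
proof -
  have sub: "D \<subseteq> arcs G" using D by (rule orientation_subset)
  then have fin: "finite D" by (rule finite_subset) simp
  have "\<exists>x :: 'a \<Rightarrow> int. (\<forall>a. 0 \<le> x a) \<and> (\<forall>a. a \<notin> D \<longrightarrow> x a = 0) \<and> x b > 0 \<and>
    (\<forall>w. (\<Sum>a\<in>out_arcs G w. x a - x (edge_rev M a)) = 0)" if b: "b \<in> D" for b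
  proof -
    have b': "b \<in> arcs G" using b sub by auto
    \<comment> \<open>Strong connectedness closes \<open>b\<close> to a directed closed walk, which
      yields a nonnegative circulation positive on \<open>b\<close>.\<close>
    have "head G b \<rightarrow>\<^sup>*\<^bsub>oriented G D\<^esub> tail G b"
      using sc b' by (auto simp: strongly_connected_def oriented_def)
    from reachable_imp_flow[OF this sub] obtain x :: "'a \<Rightarrow> int" where x: "\<forall>a. 0 \<le> x a"
      "\<forall>a. a \<notin> D \<longrightarrow> x a = 0" "\<And>w. (\<Sum>a\<in>out_arcs G w. x a - x (edge_rev M a)) =
          of_bool (w = head G b) - of_bool (w = tail G b)"
      by blast
    let ?x = "\<lambda>a. x a + of_bool (a = b)"
    have "(\<Sum>a\<in>out_arcs G v. ?x a - ?x (edge_rev M a)) = 0" for v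
      using sum_out_arcs_add_arc[OF b', of x v] x(3) by simp
    then show ?thesis using x(1,2) b by (intro exI[of _ ?x]) (auto simp: add_nonneg_pos)
  qed
  then obtain x :: "'a \<Rightarrow> 'a \<Rightarrow> int" where x: "\<And>b a. b \<in> D \<Longrightarrow> 0 \<le> x b a"
    "\<And>b a. b \<in> D \<Longrightarrow> a \<notin> D \<Longrightarrow> x b a = 0" "\<And>b. b \<in> D \<Longrightarrow> x b b > 0"
    "\<And>b w. b \<in> D \<Longrightarrow> (\<Sum>a\<in>out_arcs G w. x b a - x b (edge_rev M a)) = 0"
    by metis
  \<comment> \<open>Summing over all \<open>b\<close> makes the flow positive on all of
    \<open>D\<close>. The subtraction makes it antisymmetric and loses nothing on \<open>D\<close>,
    as reverses of arcs of \<open>D\<close> carry no flow.\<close>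
  define c where "c = (\<lambda>a. \<Sum>b\<in>D. x b a - x b (edge_rev M a))"
  have "circulation c"
    unfolding circulation_def
  proof (intro conjI ballI)
    show "c (edge_rev M a) = - c a" for a by (simp add: c_def flip: sum_negf)
    show "(\<Sum>a\<in>out_arcs G v. c a) = 0" for v
      unfolding c_def by (subst sum.swap) (simp add: x(4))
  qed
  then obtain h where h: "\<And>a. a \<in> arcs G \<Longrightarrow> c a = coboundary h a"
    using circulation_imp_coboundary by blast
  have "c a > 0" if a: "a \<in> D" for a
  proof -
    have "edge_rev M a \<notin> D" using orientation_rev[OF D] a sub by auto
    then have "c a = (\<Sum>b\<in>D. x b a)" by (simp add: c_def x(2))
    also have "\<dots> > 0" using fin a x by (intro sum_pos2[of _ a]) auto
    finally show ?thesis .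
  qed
  then show ?thesis using h sub by (intro that[of h]) force
qed

section \<open>The effect of one flip\<close>

context
  fixes D g
  assumes D: "orientation G M D" and g: "g \<in> faces G M" and ccw: "ccw_face D g"
begin

text \<open>Otherwise both darts of one edge would lie in \<open>g\<close>, hence in
  \<open>D\<close>.\<close>

lemma right_face_neq_of_left_face: "left_face M a = g \<Longrightarrow> right_face M a \<noteq> g"
proof
  assume "left_face M a = g" "right_face M a = g"
  then have "a \<in> g" "edge_rev M a \<in> g"
    using mem_face_iff[OF g] left_face_rev[of a] by auto
  then show False using orientation_rev[OF D] orientation_subset[OF D] ccw by (auto simp: ccw_face_def)
qed

lemma mem_flip_face_iff:
  "a \<in> flip_face M g D \<longleftrightarrow> a \<in> D \<and> left_face M a \<noteq> g \<or> right_face M a = g"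
proof -
  have "a \<in> edge_rev M ` g \<longleftrightarrow> edge_rev M a \<in> g"
    by (metis arev_arev image_iff)
  then show ?thesis
    using mem_face_iff[OF g] by (auto simp: flip_face_def left_face_rev)
qed

lemma left_face_imp_mem: "left_face M a = g \<Longrightarrow> a \<in> D"
  using ccw mem_face_iff[OF g] by (auto simp: ccw_face_def)

lemma right_face_imp_rev_mem: "right_face M a = g \<Longrightarrow> edge_rev M a \<in> D"
  using left_face_imp_mem left_face_rev by metis

lemma orientation_flip_face: "orientation G M (flip_face M g D)"
  unfolding orientation_def
proof (intro conjI ballI subsetI)
  fix a assume "a \<in> flip_face M g D"
  then show "a \<in> arcs G"
    using orientation_subset[OF D] right_face_imp_rev_mem[of a] arev_in_arcs[of "edge_rev M a"]
    by (auto simp: mem_flip_face_iff)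
next
  fix a assume "a \<in> arcs G"
  then show "a \<in> flip_face M g D \<longleftrightarrow> edge_rev M a \<notin> flip_face M g D"
    using orientation_rev[OF D] right_face_imp_rev_mem[of a] left_face_imp_mem[of a]
      right_face_neq_of_left_face[of a]
    by (auto simp: mem_flip_face_iff left_face_rev right_face_rev)
qed

text \<open>Darts with \<open>g\<close> on the left leave the orientation, those with
  \<open>g\<close> on the right enter it. Hence a flip at \<open>g\<close> subtracts the indicator
  of \<open>g\<close> from the potential.\<close>

lemma of_bool_flip_face:
  assumes "a \<in> arcs G"
  shows "of_bool (a \<in> flip_face M g D) = of_bool (a \<in> D) - coboundary (\<lambda>k. of_bool (k = g)) a"
  using orientation_rev[OF D assms] right_face_imp_rev_mem[of a] left_face_imp_mem[of a]
    right_face_neq_of_left_face[of a]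
  by (auto simp: mem_flip_face_iff coboundary_def)

end

section \<open>Flip sequences and flip counts\<close>

text \<open>\<open>w g\<close> prescribes the number of flips at \<open>g\<close>. The height
  \<open>h\<close> is an invariant handed on through the induction: it guarantees that some face of
  maximal \<open>w\<close> can be flipped.\<close>

lemma flip_sequence_of_counts:
  fixes w :: "'a set \<Rightarrow> nat"
  assumes "orientation G M D'" "orientation G M D"
    and "\<And>a. a \<in> arcs G \<Longrightarrow> of_bool (a \<in> D') - of_bool (a \<in> D) = coboundary (\<lambda>g. int (w g)) a"
    and "\<And>a. a \<in> D' \<Longrightarrow> coboundary h a > 0"
  shows "flip_sequence G M (\<Sum>g\<in>faces G M. w g) D' D"
  using assms
proof (induction "\<Sum>g\<in>faces G M. w g" arbitrary: D' w h)
  case 0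
  then have w: "w g = 0" if "g \<in> faces G M" for g using that finite_faces by simp
  have "a \<in> D' \<longleftrightarrow> a \<in> D" if "a \<in> arcs G" for a
    using 0(4)[OF that] w left_face_in_faces[OF that] right_face_in_faces[OF that]
    by (simp add: coboundary_def of_bool_def split: if_splits)
  then have "D' = D" using 0(2,3)[THEN orientation_subset] by auto
  then show ?case using 0(1) by (simp add: flip_sequence_def flip: 0(1))
next
  case (Suc n)
  let ?F = "faces G M"
  define S where "S = {g \<in> ?F. w g = Max (w ` ?F)}"
  have "?F \<noteq> {}" using Suc(2) by auto
  have "Max (w ` ?F) \<in> w ` ?F" using \<open>?F \<noteq> {}\<close> finite_faces by (intro Max_in) auto
  then have "S \<noteq> {}" by (auto simp: S_def)
  have "finite S" using finite_faces by (simp add: S_def)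
  then have "Max (h ` S) \<in> h ` S" using \<open>S \<noteq> {}\<close> by (intro Max_in) auto
  then obtain g where gS: "g \<in> S" "h g = Max (h ` S)" by auto
  have g: "g \<in> ?F" using gS by (simp add: S_def)
  have max_w: "w k \<le> w g" if "k \<in> ?F" for k
    using gS that finite_faces by (simp add: S_def)
  have max_h: "h k \<le> h g" if "k \<in> S" for k
    using gS that \<open>finite S\<close> by simp
  \<comment> \<open>This makes the truncated subtraction \<open>w g - 1\<close> below exact.\<close>
  have "w g > 0"
  proof (rule ccontr)
    assume "\<not> w g > 0"
    then have "(\<Sum>k\<in>?F. w k) = 0" using max_w by (intro sum.neutral) auto
    then show False using Suc(2) by simp
  qed
  have ccw: "ccw_face D' g"
    unfolding ccw_face_def
  proof
    fix a assume "a \<in> g"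
    then have la: "left_face M a = g" using mem_face_iff[OF g] by simp
    have a: "a \<in> arcs G"
    proof -
      obtain b where b: "b \<in> arcs G" "g = left_face M b" using g by (auto simp: faces_def)
      have "face_succ M permutes arcs G"
        unfolding face_succ_def by (rule permutes_compose[OF arev_permutes_arcs edge_succ_permutes])
      then show ?thesis using b \<open>a \<in> g\<close> permutes_orbit_subset by (fastforce simp: left_face_def)
    qed
    show "a \<in> D'"
    proof (rule ccontr)
      assume nin: "a \<notin> D'"
      then have rev: "edge_rev M a \<in> D'" using orientation_rev[OF Suc.prems(1) a] by simp
      \<comment> \<open>An arc missing from \<open>D'\<close> cannot have coboundary 1, so the face
        across it also maximises \<open>w\<close>. But the reverse arc lies in \<open>D'\<close>,
        making that face higher than \<open>g\<close>, against the choice of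
        \<open>g\<close>.\<close>
      have "w g \<le> w (right_face M a)"
        using Suc.prems(3)[OF a] nin la by (auto simp: coboundary_def of_bool_def split: if_splits)
      then have "right_face M a \<in> S"
        using max_w[OF right_face_in_faces[OF a]] gS right_face_in_faces[OF a] by (simp add: S_def)
      then have "h (right_face M a) \<le> h g" by (rule max_h)
      then show False
        using Suc.prems(4)[OF rev] la by (simp add: coboundary_def left_face_rev right_face_rev)
    qed
  qed
  note flip = Suc.prems(1) g ccw
  \<comment> \<open>After the flip every edge around \<open>g\<close> has \<open>g\<close> on its
    right, so putting \<open>g\<close> below all other faces restores a height function.\<close>
  let ?D = "flip_face M g D'" and ?w = "w(g := w g - 1)" and ?h = "h(g := Min (h ` ?F) - 1)"
  have "(\<Sum>k\<in>?F. w k) = w g + (\<Sum>k\<in>?F - {g}. w k)"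
    using g finite_faces by (simp add: sum.remove)
  moreover have "(\<Sum>k\<in>?F. ?w k) = (w g - 1) + (\<Sum>k\<in>?F - {g}. w k)"
    using g finite_faces by (subst sum.remove[of _ g]) auto
  ultimately have n: "n = (\<Sum>k\<in>?F. ?w k)" using Suc(2) \<open>w g > 0\<close> by simp
  have counts: "of_bool (a \<in> ?D) - of_bool (a \<in> D) = coboundary (\<lambda>k. int (?w k)) a"
    if "a \<in> arcs G" for a
    using Suc.prems(3)[OF that] of_bool_flip_face[OF flip that] \<open>w g > 0\<close>
    by (auto simp: coboundary_def of_nat_diff)
  have height: "coboundary ?h a > 0" if a: "a \<in> ?D" for a
  proof (cases "right_face M a = g")
    case True
    then have "left_face M a \<noteq> g" using right_face_neq_of_left_face[OF flip] by blast
    moreover have "a \<in> arcs G" using a orientation_subset[OF orientation_flip_face[OF flip]] by auto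
    then have "Min (h ` ?F) \<le> h (left_face M a)"
      using finite_faces left_face_in_faces by simp
    ultimately show ?thesis using True by (simp add: coboundary_def)
  next
    case False
    then have "a \<in> D'" "left_face M a \<noteq> g" using a mem_flip_face_iff[OF flip] by auto
    then show ?thesis using False Suc.prems(4)[of a] by (simp add: coboundary_def)
  qed
  have "flip_sequence G M n ?D D"
    unfolding n
    using Suc(1)[OF n orientation_flip_face[OF flip] Suc.prems(2) counts height] .
  moreover have "flip_step G M D' ?D" using g ccw by (auto simp: flip_step_def)
  ultimately show ?case
    unfolding Suc(2)[symmetric] flip_sequence_def by (rule relpowp_Suc_I2[rotated])
qed

text \<open>The witness counts the flips at each face; by \<open>of_bool_flip_face\<close> each flip
  contributes the coboundary of an indicator.\<close>

lemma counts_of_flip_sequence: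
  assumes "flip_sequence G M n D' D" "orientation G M D'"
  shows "\<exists>w :: 'a set \<Rightarrow> nat. (\<Sum>g\<in>faces G M. w g) = n \<and>
    (\<forall>a\<in>arcs G. of_bool (a \<in> D') - of_bool (a \<in> D) = coboundary (\<lambda>g. int (w g)) a)"
  using assms
proof (induction n arbitrary: D')
  case 0
  then show ?case
    by (intro exI[of _ "\<lambda>_. 0"]) (auto simp: flip_sequence_def coboundary_def)
next
  case (Suc n)
  then obtain D1 where D1: "flip_step G M D' D1" "flip_sequence G M n D1 D"
    unfolding flip_sequence_def by (meson relpowp_Suc_D2)
  then obtain g where g: "g \<in> faces G M" "ccw_face D' g" "D1 = flip_face M g D'"
    by (auto simp: flip_step_def)
  note flip = Suc.prems(2) g(1,2)
  obtain w :: "'a set \<Rightarrow> nat" where w: "(\<Sum>g\<in>faces G M. w g) = n"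
    "\<forall>a\<in>arcs G. of_bool (a \<in> D1) - of_bool (a \<in> D) = coboundary (\<lambda>g. int (w g)) a"
    using Suc.IH[OF D1(2)] orientation_flip_face[OF flip] g(3) by blast
  let ?w = "\<lambda>k. w k + of_bool (k = g)"
  have "(\<Sum>k\<in>faces G M. ?w k) = Suc n"
    using w(1) g(1) finite_faces by (simp add: sum.distrib of_bool_def)
  moreover have "of_bool (a \<in> D') - of_bool (a \<in> D) = coboundary (\<lambda>k. int (?w k)) a"
    if "a \<in> arcs G" for a
    using w(2)[rule_format, OF that] of_bool_flip_face[OF flip that] g(3)
    by (simp add: coboundary_def)
  ultimately show ?case by (intro exI[of _ ?w]) auto
qed

section \<open>The potential as a coboundary\<close>

lemma is_potential_iff_coboundary:
  assumes "orientation G M D" "orientation G M D'"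
  shows "is_potential G M D' D f z \<longleftrightarrow> z f = 0 \<and>
    (\<forall>a\<in>arcs G. of_bool (a \<in> D') - of_bool (a \<in> D) = coboundary z a)"
proof -
  have "z (left_face M a) =
        (if a \<in> D' - D then z (right_face M a) + 1
         else if edge_rev M a \<in> D' - D then z (right_face M a) - 1
         else z (right_face M a)) \<longleftrightarrow>
     of_bool (a \<in> D') - of_bool (a \<in> D) = coboundary z a" if "a \<in> arcs G" for a
    using assms[THEN orientation_rev, OF that] by (auto simp: coboundary_def)
  then show ?thesis by (simp add: is_potential_def)
qed

text \<open>This justifies the definite description. A face function for the difference circulation,
  shifted to vanish at \<open>f\<close>, exists; two such functions differ by a constant, which is 0
  at \<open>f\<close>.\<close>

lemma is_potential_potential:
  assumes D: "alpha_orientation G M \<alpha> D" and D': "alpha_orientation G M \<alpha> D'" and f: "f \<in> faces G M"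
  shows "is_potential G M D' D f (potential G M D' D f)"
proof -
  have or: "orientation G M D" "orientation G M D'" using D D' by (auto simp: alpha_orientation_def)
  note pot_iff = is_potential_iff_coboundary[OF or]
  obtain z where z: "\<And>a. a \<in> arcs G \<Longrightarrow> of_bool (a \<in> D') - of_bool (a \<in> D) = coboundary z a"
    using circulation_imp_coboundary[OF circulation_orientation_diff[OF D D']] by blast
  let ?z = "restrict (\<lambda>g. z g - z f) (faces G M)"
  have "\<exists>!z. z \<in> extensional (faces G M) \<and> is_potential G M D' D f z"
  proof (rule ex1I)
    show "?z \<in> extensional (faces G M) \<and> is_potential G M D' D f ?z"
      using f z left_face_in_faces right_face_in_faces by (auto simp: pot_iff coboundary_def)
  next
    fix y assume y: "y \<in> extensional (faces G M) \<and> is_potential G M D' D f y"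
    have "coboundary (\<lambda>g. y g - z g) a = 0" if "a \<in> arcs G" for a
      using y z[OF that] that by (simp add: pot_iff coboundary_def)
    then have "y g - z g = y f - z f" if "g \<in> faces G M" for g
      using coboundary_eq_0_imp_const[of "\<lambda>g. y g - z g"] that f by blast
    then have "y g = ?z g" if "g \<in> faces G M" for g using that y by (force simp: pot_iff)
    then show "y = ?z" using y by (intro extensionalityI[of _ "faces G M"]) auto
  qed
  from theI'[OF this] show ?thesis by (simp add: potential_def)
qed

end

section \<open>The flip-distance\<close>

theorem theorem4p1:
  fixes G :: "('v, 'a) pre_digraph" and M :: "'a comb_map"
    and \<alpha> :: "'v \<Rightarrow> nat" and D D' f :: "'a set"
  assumes "sphere_graph G M"
    and "two_connected G M"
    and "alpha_orientation G M \<alpha> D" and "strongly_connected (oriented G D)"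
    and "alpha_orientation G M \<alpha> D'" and "strongly_connected (oriented G D')"
    and "f \<in> faces G M"
  shows "(\<exists>n. flip_sequence G M n D' D) \<and>
    int (flip_distance G M D' D) =
      (\<Sum>g \<in> faces G M. potential G M D' D f g - z_min G M D' D f)"
proof -
  interpret sphere_graph G M by fact
  let ?F = "faces G M"
  define z where "z = potential G M D' D f"
  define m where "m = z_min G M D' D f"
  have or: "orientation G M D" "orientation G M D'"
    using assms by (auto simp: alpha_orientation_def)
  have z: "of_bool (a \<in> D') - of_bool (a \<in> D) = coboundary z a" if "a \<in> arcs G" for a
    using is_potential_potential[OF assms(3,5,7)] that
    by (simp add: is_potential_iff_coboundary[OF or] z_def)
  have m: "m = Min (z ` ?F)" by (simp add: m_def z_min_def z_def)
  then have m_le: "m \<le> z g" if "g \<in> ?F" for g using that finite_faces by simp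
  have "m \<in> z ` ?F" unfolding m using finite_faces assms(7) by (intro Min_in) auto
  then obtain g0 where g0: "g0 \<in> ?F" "m = z g0" by blast
  define w where "w = (\<lambda>g. nat (z g - m))"
  have w: "int (w g) = z g - m" if "g \<in> ?F" for g using m_le[OF that] by (simp add: w_def)
  obtain h where "\<And>a. a \<in> D' \<Longrightarrow> coboundary h a > 0"
    using strongly_connected_imp_height[OF or(2) assms(6)] by blast
  then have seq: "flip_sequence G M (\<Sum>g\<in>?F. w g) D' D"
    using z w left_face_in_faces right_face_in_faces
    by (intro flip_sequence_of_counts[OF or(2,1)]) (auto simp: coboundary_def)
  \<comment> \<open>The flip counts \<open>x\<close> of any sequence have the same coboundary as
    \<open>z\<close>, so \<open>x - z\<close> is constant. As \<open>z\<close> attains its minimum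
    at \<open>g0\<close> and \<open>x g0\<close> is nonnegative, \<open>w\<close> is pointwise at
    most \<open>x\<close>.\<close>
  have lower: "(\<Sum>g\<in>?F. w g) \<le> n" if n: "flip_sequence G M n D' D" for n
  proof -
    obtain x :: "'a set \<Rightarrow> nat" where x: "(\<Sum>g\<in>?F. x g) = n"
      "\<forall>a\<in>arcs G. of_bool (a \<in> D') - of_bool (a \<in> D) = coboundary (\<lambda>g. int (x g)) a"
      using counts_of_flip_sequence[OF n or(2)] by blast
    have "coboundary (\<lambda>g. int (x g) - z g) a = 0" if "a \<in> arcs G" for a
      using x(2) z[OF that] that by (simp add: coboundary_def)
    then have "int (x g) - z g = int (x g0) - z g0" if "g \<in> ?F" for g
      using coboundary_eq_0_imp_const[of "\<lambda>g. int (x g) - z g"] that g0(1) by blast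
    then have "w g \<le> x g" if "g \<in> ?F" for g
      using that g0(2) by (force simp: w_def)
    then show ?thesis unfolding x(1)[symmetric] by (rule sum_mono)
  qed
  have "flip_distance G M D' D = (\<Sum>g\<in>?F. w g)"
    unfolding flip_distance_def using seq lower by (rule Least_equality)
  then show ?thesis using seq w by (auto simp: z_def m_def)
qed

end
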